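(* Let $\mathfrak{O}$ be the valuation ring of a non-Archimedean local field of arbitrary characteristic, with residue field size $q$. Let $d>1$. Then $$\mathsf{Z}_{\mathfrak{sl}_d(\mathfrak{O})}(T) = \mathsf{Z}_{\mathfrak{gl}_d(\mathfrak{O})}(T) = \frac{1-q^{-d}T}{(1-T)^2}.$$
   Context: $\mathfrak{gl}_d(\mathfrak{O})=\mathrm{M}_d(\mathfrak{O})$ and $\mathfrak{sl}_d(\mathfrak{O})=\{a\in\mathfrak{gl}_d(\mathfrak{O}):\mathrm{trace}(a)=0\}$. Let $\mathfrak{P}$ be the maximal ideal of $\mathfrak{O}$ and $\mathfrak{O}_n=\mathfrak{O}/\mathfrak{P}^n$. For an $\mathfrak{O}$-submodule $M\subset\mathrm{M}_{d}(\mathfrak{O})$, let $M_n$ be its image in $\mathrm{M}_{d}(\mathfrak{O}_n)$ under entrywise reduction. The ask zeta function of $M$ is $\mathsf{Z}_M(T)=\sum_{n=0}^\infty \bigl(|M_n|^{-1}\sum_{a\in M_n}|\mathrm{Ker}(a)|\bigr)T^n$, where $\mathrm{Ker}(a)=\{x\in\mathfrak{O}_n^d: xa=0\}$ (row vectors). *)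

theory Defs
  imports
    "HOL-Algebra.Algebra"
    "HOL-Computational_Algebra.Formal_Power_Series"
begin

section \<open>Non-Archimedean local fields\<close>

text \<open>
  A discrete valuation is given by an integer-valued function \<open>v\<close>, of which only the values
  on nonzero elements matter; \<open>val_ge K v k x\<close> expresses \<open>v x \<ge> k\<close> under the convention
  \<open>v 0 = \<infinity>\<close>.
\<close>

definition val_ge :: "('a, 'b) ring_scheme \<Rightarrow> ('a \<Rightarrow> int) \<Rightarrow> int \<Rightarrow> 'a \<Rightarrow> bool"
  where "val_ge K v k x \<longleftrightarrow> x = \<zero>\<^bsub>K\<^esub> \<or> k \<le> v x"

definition valuation_ring :: "('a, 'b) ring_scheme \<Rightarrow> ('a \<Rightarrow> int) \<Rightarrow> ('a, 'b) ring_scheme"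
  where "valuation_ring K v = K \<lparr> carrier := {x \<in> carrier K. val_ge K v 0 x} \<rparr>"

definition valuation_ideal :: "('a, 'b) ring_scheme \<Rightarrow> ('a \<Rightarrow> int) \<Rightarrow> 'a set"
  where "valuation_ideal K v = {x \<in> carrier K. val_ge K v 1 x}"

definition val_Cauchy :: "('a, 'b) ring_scheme \<Rightarrow> ('a \<Rightarrow> int) \<Rightarrow> (nat \<Rightarrow> 'a) \<Rightarrow> bool"
  where "val_Cauchy K v s \<longleftrightarrow>
    (\<forall>k. \<exists>N. \<forall>i\<ge>N. \<forall>j\<ge>N. val_ge K v k (s i \<ominus>\<^bsub>K\<^esub> s j))"

definition val_limit :: "('a, 'b) ring_scheme \<Rightarrow> ('a \<Rightarrow> int) \<Rightarrow> (nat \<Rightarrow> 'a) \<Rightarrow> 'a \<Rightarrow> bool"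
  where "val_limit K v s l \<longleftrightarrow> (\<forall>k. \<exists>N. \<forall>i\<ge>N. val_ge K v k (s i \<ominus>\<^bsub>K\<^esub> l))"

text \<open>
  A non-Archimedean local field is a field that is complete with respect to a discrete
  valuation with finite residue field; the valuation is normalized to have value group \<open>\<int>\<close>.
\<close>

locale nonarch_local_field = Ring.field K
  for K :: "('a, 'b) ring_scheme" (structure) and v :: "'a \<Rightarrow> int" +
  assumes val_mult: "\<lbrakk>x \<in> carrier K - {\<zero>}; y \<in> carrier K - {\<zero>}\<rbrakk> \<Longrightarrow> v (x \<otimes> y) = v x + v y"
    and val_add: "\<lbrakk>x \<in> carrier K; y \<in> carrier K; val_ge K v k x; val_ge K v k y\<rbrakk>
                    \<Longrightarrow> val_ge K v k (x \<oplus> y)"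
    and val_surj: "v ` (carrier K - {\<zero>}) = UNIV"
    and val_complete: "\<lbrakk>range s \<subseteq> carrier K; val_Cauchy K v s\<rbrakk> \<Longrightarrow> \<exists>l\<in>carrier K. val_limit K v s l"
    and finite_residue_field: "finite (carrier (valuation_ring K v Quot valuation_ideal K v))"
begin

lemma val_one: "v \<one> = 0"
  using val_mult[of \<one> \<one>] by simp

lemma val_minus: "x \<in> carrier K - {\<zero>} \<Longrightarrow> v (\<ominus> x) = v x"
proof -
  assume x: "x \<in> carrier K - {\<zero>}"
  have n1: "\<ominus> \<one> \<in> carrier K - {\<zero>}"
    by (metis Diff_iff a_inv_closed add.inv_eq_1_iff one_closed singletonD zero_not_one)
  have "v (\<ominus> \<one>) = 0"
    using val_mult[OF n1 n1] val_one by (simp add: l_minus r_minus)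
  moreover have "\<ominus> \<one> \<otimes> x = \<ominus> x"
    using x by (simp add: l_minus)
  ultimately show ?thesis
    using val_mult[OF n1 x] by simp
qed

lemma val_ge_minus: "\<lbrakk>x \<in> carrier K; val_ge K v k x\<rbrakk> \<Longrightarrow> val_ge K v k (\<ominus> x)"
  using val_minus[of x] by (auto simp: val_ge_def)

lemma val_ge_mult:
  "\<lbrakk>x \<in> carrier K; y \<in> carrier K; val_ge K v k x; val_ge K v l y\<rbrakk> \<Longrightarrow> val_ge K v (k + l) (x \<otimes> y)"
  using val_mult[of x y] by (cases "x = \<zero> \<or> y = \<zero>") (auto simp: val_ge_def)

lemma valuation_ring_is_domain: "domain (valuation_ring K v)"
proof -
  have "subring {x \<in> carrier K. val_ge K v 0 x} K"
  proof (rule subringI)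
    show "\<one> \<in> {x \<in> carrier K. val_ge K v 0 x}"
      by (simp add: val_ge_def val_one)
  qed (use val_ge_minus val_add val_ge_mult[of _ _ 0 0] in auto)
  then show ?thesis
    unfolding valuation_ring_def using subring_is_domain by blast
qed

lemma valuation_ideal_is_ideal: "ideal (valuation_ideal K v) (valuation_ring K v)"
proof -
  interpret O: domain "valuation_ring K v" by (rule valuation_ring_is_domain)
  have inv: "\<ominus>\<^bsub>valuation_ring K v\<^esub> x = \<ominus> x" if "x \<in> valuation_ideal K v" for x
  proof (rule O.minus_equality)
    show "\<ominus> x \<in> carrier (valuation_ring K v)" "x \<in> carrier (valuation_ring K v)"
      using that val_ge_minus[of x 0]
      by (auto simp: valuation_ideal_def valuation_ring_def val_ge_def)
    show "\<ominus> x \<oplus>\<^bsub>valuation_ring K v\<^esub> x = \<zero>\<^bsub>valuation_ring K v\<^esub>"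
      using that by (auto simp: valuation_ideal_def valuation_ring_def l_neg)
  qed
  show ?thesis
  proof (rule idealI)
    show "ring (valuation_ring K v)" by (rule O.ring_axioms)
    show "subgroup (valuation_ideal K v) (add_monoid (valuation_ring K v))"
    proof (rule O.add.subgroupI)
      show "valuation_ideal K v \<subseteq> carrier (valuation_ring K v)"
        by (auto simp: valuation_ideal_def valuation_ring_def val_ge_def)
      show "valuation_ideal K v \<noteq> {}"
        by (auto simp: valuation_ideal_def val_ge_def)
    next
      fix x assume x: "x \<in> valuation_ideal K v"
      then show "\<ominus>\<^bsub>valuation_ring K v\<^esub> x \<in> valuation_ideal K v"
        using inv[OF x] val_ge_minus by (auto simp: valuation_ideal_def)
    qed (use val_add in \<open>auto simp: valuation_ideal_def valuation_ring_def\<close>)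
  qed (use val_ge_mult[of _ _ 0 1] val_ge_mult[of _ _ 1 0]
        in \<open>auto simp: valuation_ideal_def valuation_ring_def\<close>)
qed

lemma not_in_valuation_ideal_Units:
  assumes "x \<in> carrier (valuation_ring K v)" "x \<notin> valuation_ideal K v"
  shows "x \<in> Units (valuation_ring K v)"
proof -
  have x: "x \<in> carrier K - {\<zero>}" and vx: "v x = 0"
    using assms by (auto simp: valuation_ring_def valuation_ideal_def val_ge_def)
  have i: "inv x \<in> carrier K - {\<zero>}" and e: "x \<otimes> inv x = \<one>" "inv x \<otimes> x = \<one>"
    using x field_Units by auto
  have "v (inv x) = 0"
    using val_mult[OF x i] e val_one vx by simp
  then have "inv x \<in> carrier (valuation_ring K v)"
    using i by (auto simp: valuation_ring_def val_ge_def)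
  then show ?thesis
    using e assms(1) unfolding Units_def by (auto simp: valuation_ring_def)
qed

lemma proper_ideal_le_valuation_ideal:
  assumes "ideal J (valuation_ring K v)" "J \<noteq> carrier (valuation_ring K v)"
  shows "J \<subseteq> valuation_ideal K v"
proof
  interpret J: ideal J "valuation_ring K v" by fact
  fix x assume x: "x \<in> J"
  show "x \<in> valuation_ideal K v"
  proof (rule ccontr)
    assume "x \<notin> valuation_ideal K v"
    then have u: "x \<in> Units (valuation_ring K v)"
      using not_in_valuation_ideal_Units J.Icarr[OF x] by blast
    then have "\<one>\<^bsub>valuation_ring K v\<^esub> \<in> J"
      using J.I_l_closed[OF x J.Units_inv_closed[OF u]] J.Units_l_inv[OF u] by simp
    then show False
      using J.one_imp_carrier assms(2) by blast
  qed
qed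

lemma one_not_in_valuation_ideal: "\<one> \<notin> valuation_ideal K v"
  by (simp add: valuation_ideal_def val_ge_def val_one)

theorem valuation_ideal_unique_maximal:
  "maximalideal I (valuation_ring K v) \<longleftrightarrow> I = valuation_ideal K v"
proof
  have one: "\<one> \<in> carrier (valuation_ring K v)"
    by (simp add: valuation_ring_def val_ge_def val_one)
  have ne: "carrier (valuation_ring K v) \<noteq> valuation_ideal K v"
    using one one_not_in_valuation_ideal by blast
  {
    assume "maximalideal I (valuation_ring K v)"
    then interpret I: maximalideal I "valuation_ring K v" .
    have "I \<subseteq> valuation_ideal K v"
      using proper_ideal_le_valuation_ideal I.ideal_axioms I.I_notcarr by metis
    then show "I = valuation_ideal K v"
      using I.I_maximal[OF valuation_ideal_is_ideal] ne
        additive_subgroup.a_subset[OF ideal.axioms(1)[OF valuation_ideal_is_ideal]] by metis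
  next
    assume "I = valuation_ideal K v"
    then show "maximalideal I (valuation_ring K v)"
      using valuation_ideal_is_ideal ne proper_ideal_le_valuation_ideal
      by (auto intro!: maximalidealI)
  }
qed

end


section \<open>Vectors and matrices over a ring\<close>

text \<open>Indices run over \<open>0, \<dots>, d - 1\<close>; outside this range, the functions are \<open>undefined\<close>.\<close>

definition vecs :: "('a, 'b) ring_scheme \<Rightarrow> nat \<Rightarrow> (nat \<Rightarrow> 'a) set"
  where "vecs R d = {..<d} \<rightarrow>\<^sub>E carrier R"

definition gl_mats :: "('a, 'b) ring_scheme \<Rightarrow> nat \<Rightarrow> (nat \<times> nat \<Rightarrow> 'a) set"
  where "gl_mats R d = {..<d} \<times> {..<d} \<rightarrow>\<^sub>E carrier R"

definition mat_trace :: "('a, 'b) ring_scheme \<Rightarrow> nat \<Rightarrow> (nat \<times> nat \<Rightarrow> 'a) \<Rightarrow> 'a"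
  where "mat_trace R d a = (\<Oplus>\<^bsub>R\<^esub>i\<in>{..<d}. a (i, i))"

definition sl_mats :: "('a, 'b) ring_scheme \<Rightarrow> nat \<Rightarrow> (nat \<times> nat \<Rightarrow> 'a) set"
  where "sl_mats R d = {a \<in> gl_mats R d. mat_trace R d a = \<zero>\<^bsub>R\<^esub>}"

definition row_mult :: "('a, 'b) ring_scheme \<Rightarrow> nat \<Rightarrow> (nat \<Rightarrow> 'a) \<Rightarrow> (nat \<times> nat \<Rightarrow> 'a) \<Rightarrow> nat \<Rightarrow> 'a"
  where "row_mult R d x a = (\<lambda>j\<in>{..<d}. \<Oplus>\<^bsub>R\<^esub>i\<in>{..<d}. x i \<otimes>\<^bsub>R\<^esub> a (i, j))"

definition row_kernel :: "('a, 'b) ring_scheme \<Rightarrow> nat \<Rightarrow> (nat \<times> nat \<Rightarrow> 'a) \<Rightarrow> (nat \<Rightarrow> 'a) set"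
  where "row_kernel R d a = {x \<in> vecs R d. row_mult R d x a = (\<lambda>j\<in>{..<d}. \<zero>\<^bsub>R\<^esub>)}"


section \<open>Ask zeta functions\<close>

text \<open>
  Below, \<open>R\<close> and \<open>P\<close> play the roles of the valuation ring and its maximal ideal. Powers of
  ideals are taken in the monoid \<^const>\<open>ideals_set\<close>, so that the zeroth power is
  \<^term>\<open>carrier R\<close>.
\<close>

definition trunc_ideal :: "('a, 'b) ring_scheme \<Rightarrow> 'a set \<Rightarrow> nat \<Rightarrow> 'a set"
  where "trunc_ideal R P n = P [^]\<^bsub>ideals_set R\<^esub> n"

definition trunc_ring :: "('a, 'b) ring_scheme \<Rightarrow> 'a set \<Rightarrow> nat \<Rightarrow> 'a set ring"
  where "trunc_ring R P n = R Quot trunc_ideal R P n"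

definition reduce_mat ::
    "('a, 'b) ring_scheme \<Rightarrow> 'a set \<Rightarrow> nat \<Rightarrow> nat \<Rightarrow> (nat \<times> nat \<Rightarrow> 'a) \<Rightarrow> (nat \<times> nat \<Rightarrow> 'a set)"
  where "reduce_mat R P d n a =
    (\<lambda>ij\<in>{..<d} \<times> {..<d}. trunc_ideal R P n +>\<^bsub>R\<^esub> a ij)"

definition ask_zeta ::
    "('a, 'b) ring_scheme \<Rightarrow> 'a set \<Rightarrow> nat \<Rightarrow> (nat \<times> nat \<Rightarrow> 'a) set \<Rightarrow> rat fps"
  where "ask_zeta R P d M = Abs_fps (\<lambda>n. let Mn = reduce_mat R P d n ` M in
    (\<Sum>a\<in>Mn. of_nat (card (row_kernel (trunc_ring R P n) d a))) / of_nat (card Mn))"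

end

theory Submission
  imports Defs
begin

text \<open>
  Write \<open>S\<close> for the finite ring \<open>R / P^n\<close> and let \<open>p\<close> be the image of a uniformizer. Let \<open>M\<close> be
  an additive group of matrices over \<open>S\<close> that contains all matrices of trace zero. Counting the
  pairs \<open>(x, a)\<close> with \<open>x a = 0\<close> by \<open>x\<close> instead of by \<open>a\<close> turns the average size of the kernel
  of \<open>a \<in> M\<close> into the sum over all row vectors \<open>x\<close> of the proportion of the \<open>a \<in> M\<close> that
  annihilate \<open>x\<close>. For fixed \<open>x\<close>, this proportion is the inverse of the size of the image of the
  additive map \<open>a \<mapsto> x a\<close> (\<open>card_kernel_times_card_image\<close>).

  If the entries of \<open>x\<close> lie in \<open>p^k S\<close>, but not all of them in \<open>p^(k+1) S\<close>, then this image
  consists of all vectors over \<open>p^k S\<close> (\<open>row_mult_image\<close>). This is where \<open>d > 1\<close> enters: a matrix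
  that is supported on a single row already sends \<open>x\<close> to any such vector, and a second row leaves
  room to make its trace vanish. Hence trace-zero matrices and arbitrary matrices have the same
  averages.

  As \<open>p^k S\<close> has \<open>q^(n-k)\<close> elements, the vectors \<open>x\<close> that belong to a given \<open>k < n\<close> contribute
  \<open>(q^(d(n-k)) - q^(d(n-k-1))) / q^(d(n-k)) = 1 - q^(-d)\<close> in total, and the zero vector
  contributes \<open>1\<close>. The average is therefore \<open>1 + n (1 - q^(-d))\<close>
  (\<open>average_card_row_kernel\<close>), which is the coefficient of \<open>T^n\<close> in
  \<open>(1 - q^(-d) T) / (1 - T)^2\<close>.

  What remains is to see that \<open>R / P^n\<close> has the two properties used above: its elements are
  comparable with the powers of \<open>p\<close>, and \<open>p^k S\<close> has \<open>q^(n-k)\<close> elements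
  (\<open>finite_chain_ring_trunc\<close>), and that the reductions of the matrices of trace zero over \<open>R\<close>
  are all the matrices of trace zero over \<open>R / P^n\<close> (\<open>reduce_mat_sl_mats\<close>).
\<close>

section \<open>Counting with homomorphisms\<close>

lemma (in group_hom) card_kernel_times_card_image:
  "card (kernel G H h) * card (h ` carrier G) = order G"
proof -
  interpret im: group_hom G "H\<lparr>carrier := h ` carrier G\<rparr>" h
  proof (intro group_hom.intro group_hom_axioms.intro G.group_axioms)
    show "group (H\<lparr>carrier := h ` carrier G\<rparr>)"
      by (rule subgroup.subgroup_is_group[OF img_is_subgroup]) (rule H.group_axioms)
    show "h \<in> hom G (H\<lparr>carrier := h ` carrier G\<rparr>)"
      by (auto simp: hom_def)
  qed
  have ker: "kernel G (H\<lparr>carrier := h ` carrier G\<rparr>) h = kernel G H h"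
    by (simp add: kernel_def)
  have "card (rcosets (kernel G H h)) = card (h ` carrier G)"
    using im.FactGroup_iso_set
    by (auto simp: ker iso_def FactGroup_def intro: bij_betw_same_card)
  then show ?thesis
    using G.lagrange[OF subgroup_kernel] by (simp add: mult.commute)
qed

lemma card_image_eq_if_same_fibres:
  assumes "\<And>x y. \<lbrakk>x \<in> A; y \<in> A\<rbrakk> \<Longrightarrow> f x = f y \<longleftrightarrow> g x = g y"
  shows "card (f ` A) = card (g ` A)"
proof (rule bij_betw_same_card)
  have r: "inv_into A f (f x) \<in> A" "f (inv_into A f (f x)) = f x" if "x \<in> A" for x
    using that by (auto simp: inv_into_into f_inv_into_f)
  then have "g (inv_into A f (f x)) = g x" if "x \<in> A" for x
    using assms that by blast
  then show "bij_betw (\<lambda>y. g (inv_into A f y)) (f ` A) (g ` A)"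
    using assms by (auto simp: bij_betw_def inj_on_def image_image)
qed

lemma (in abelian_monoid) finsum_two:
  assumes "finite A" "i \<in> A" "j \<in> A" "i \<noteq> j" "f i \<in> carrier G" "f j \<in> carrier G"
    and "\<And>r. r \<in> A - {i, j} \<Longrightarrow> f r = \<zero>"
  shows "(\<Oplus>r\<in>A. f r) = f i \<oplus> f j"
proof -
  have "(\<Oplus>r\<in>A. f r) = (\<Oplus>r\<in>{i, j}. f r)"
  proof (rule add.finprod_mono_neutral_cong_right)
    show "f \<in> A \<rightarrow> carrier G" using assms by (metis DiffI Pi_I insert_iff empty_iff zero_closed)
  qed (use assms in auto)
  also have "\<dots> = f i \<oplus> f j"
    using assms by (simp add: finsum_insert)
  finally show ?thesis .
qed

section \<open>Additive groups of matrices\<close>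

abbreviation mat_group :: "('a, 'b) ring_scheme \<Rightarrow> nat \<Rightarrow> (nat \<times> nat \<Rightarrow> 'a) monoid"
  where "mat_group R d \<equiv> product_group ({..<d} \<times> {..<d}) (\<lambda>_. add_monoid R)"

abbreviation vec_group :: "('a, 'b) ring_scheme \<Rightarrow> nat \<Rightarrow> (nat \<Rightarrow> 'a) monoid"
  where "vec_group R d \<equiv> product_group {..<d} (\<lambda>_. add_monoid R)"

lemma (in ring) group_mat_group: "group (mat_group R d)"
  by (simp add: a_group)

lemma (in ring) group_vec_group: "group (vec_group R d)"
  by (simp add: a_group)

lemma (in ring) row_mult_hom:
  assumes x: "x \<in> vecs R d"
  shows "row_mult R d x \<in> hom (mat_group R d) (vec_group R d)"
proof (rule homI)
  have xc: "x i \<in> carrier R" if "i < d" for i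
    using x that by (auto simp: vecs_def)
  fix a assume a: "a \<in> carrier (mat_group R d)"
  then have ac: "a (i, j) \<in> carrier R" if "i < d" "j < d" for i j
    using that by auto
  show "row_mult R d x a \<in> carrier (vec_group R d)"
    using xc ac by (auto simp: row_mult_def intro!: finsum_closed)
  fix b assume b: "b \<in> carrier (mat_group R d)"
  then have bc: "b (i, j) \<in> carrier R" if "i < d" "j < d" for i j
    using that by auto
  have "(\<Oplus>i\<in>{..<d}. x i \<otimes> (a (i, j) \<oplus> b (i, j)))
      = (\<Oplus>i\<in>{..<d}. x i \<otimes> a (i, j)) \<oplus> (\<Oplus>i\<in>{..<d}. x i \<otimes> b (i, j))" if "j < d" for j
  proof -
    have "(\<Oplus>i\<in>{..<d}. x i \<otimes> (a (i, j) \<oplus> b (i, j)))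
      = (\<Oplus>i\<in>{..<d}. x i \<otimes> a (i, j) \<oplus> x i \<otimes> b (i, j))"
      using xc ac bc that by (intro finsum_cong') (auto simp: r_distr)
    also have "\<dots> = (\<Oplus>i\<in>{..<d}. x i \<otimes> a (i, j)) \<oplus> (\<Oplus>i\<in>{..<d}. x i \<otimes> b (i, j))"
      using xc ac bc that by (intro finsum_addf) auto
    finally show ?thesis .
  qed
  moreover have "(\<Oplus>i\<in>{..<d}. x i \<otimes> (a \<otimes>\<^bsub>mat_group R d\<^esub> b) (i, j))
      = (\<Oplus>i\<in>{..<d}. x i \<otimes> (a (i, j) \<oplus> b (i, j)))" if "j < d" for j
    using xc ac bc that by (intro finsum_cong') auto
  ultimately show "row_mult R d x (a \<otimes>\<^bsub>mat_group R d\<^esub> b)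
      = row_mult R d x a \<otimes>\<^bsub>vec_group R d\<^esub> row_mult R d x b"
    by (auto simp: row_mult_def fun_eq_iff)
qed

lemma (in ring) mat_trace_hom: "mat_trace R d \<in> hom (mat_group R d) (add_monoid R)"
proof (rule homI)
  fix a b assume a: "a \<in> carrier (mat_group R d)" and b: "b \<in> carrier (mat_group R d)"
  have ac: "a (i, i) \<in> carrier R" and bc: "b (i, i) \<in> carrier R" if "i < d" for i
    using a b that by auto
  show "mat_trace R d a \<in> carrier (add_monoid R)"
    using ac by (auto simp: mat_trace_def intro!: finsum_closed)
  have "mat_trace R d (a \<otimes>\<^bsub>mat_group R d\<^esub> b) = (\<Oplus>i\<in>{..<d}. a (i, i) \<oplus> b (i, i))"
    unfolding mat_trace_def using ac bc by (intro finsum_cong') auto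
  also have "\<dots> = mat_trace R d a \<oplus> mat_trace R d b"
    unfolding mat_trace_def using ac bc by (intro finsum_addf) auto
  finally show "mat_trace R d (a \<otimes>\<^bsub>mat_group R d\<^esub> b)
      = mat_trace R d a \<otimes>\<^bsub>add_monoid R\<^esub> mat_trace R d b"
    by simp
qed

lemma (in ring) subgroup_gl_mats: "subgroup (gl_mats R d) (mat_group R d)"
  using group.subgroup_self[OF group_mat_group] by (simp add: gl_mats_def)

lemma (in ring) subgroup_sl_mats: "subgroup (sl_mats R d) (mat_group R d)"
proof -
  interpret group_hom "mat_group R d" "add_monoid R" "mat_trace R d"
    using group_mat_group a_group mat_trace_hom
    by (simp add: group_hom_def group_hom_axioms_def)
  have "sl_mats R d = kernel (mat_group R d) (add_monoid R) (mat_trace R d)"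
    by (simp add: sl_mats_def gl_mats_def kernel_def)
  then show ?thesis
    using subgroup_kernel by simp
qed

section \<open>Average kernel sizes over finite chain rings\<close>

lemma cgenideal_eq_image: "PIdl\<^bsub>R\<^esub> a = (\<lambda>x. x \<otimes>\<^bsub>R\<^esub> a) ` carrier R"
  by (auto simp: cgenideal_def)

lemma (in cring) cgenideal_one: "PIdl \<one> = carrier R"
  unfolding cgenideal_eq_image by (simp cong: image_cong_simp)

lemma (in ring) r_mult_hom_add_monoid:
  "a \<in> carrier R \<Longrightarrow> (\<lambda>x. x \<otimes> a) \<in> hom (add_monoid R) (add_monoid R)"
  by (auto simp: hom_def l_distr)

text \<open>
  The model is \<open>R / P^n\<close> with residue field of size \<open>q\<close> and \<open>p\<close> the image of a uniformizer. The
  first property of \<open>p\<close> says that an element of valuation at most \<open>k\<close> divides \<open>p^k\<close>. The zero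
  ring, with \<open>n = 0\<close>, is admitted, so that the constant term of the zeta function needs no
  separate treatment.
\<close>

locale finite_chain_ring = cring S for S :: "('a, 'b) ring_scheme" (structure) +
  fixes p :: 'a and n q :: nat
  assumes p_closed [simp, intro]: "p \<in> carrier S"
    and q_pos: "0 < q"
    and pow_in_cgenideal:
      "\<lbrakk>x \<in> carrier S; x \<notin> PIdl (p [^] Suc k)\<rbrakk> \<Longrightarrow> p [^] k \<in> PIdl x"
    and card_cgenideal_pow: "k \<le> n \<Longrightarrow> card (PIdl (p [^] k)) = q ^ (n - k)"
begin

definition layer :: "nat \<Rightarrow> nat \<Rightarrow> (nat \<Rightarrow> 'a) set"
  where "layer d k = {..<d} \<rightarrow>\<^sub>E PIdl (p [^] k)"

lemma ideal_pow: "ideal (PIdl (p [^] (k::nat))) S"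
  by (simp add: cgenideal_ideal)

lemma finite_cgenideal_pow: "k \<le> n \<Longrightarrow> finite (PIdl (p [^] k))"
  using card_cgenideal_pow q_pos by (intro card_ge_0_finite) simp

lemma layer_0: "layer d 0 = vecs S d"
  by (simp add: layer_def vecs_def cgenideal_one)

lemma finite_carrier: "finite (carrier S)"
  using finite_cgenideal_pow[of 0] by (simp add: cgenideal_one)

lemma layer_Suc_subset: "layer d (Suc k) \<subseteq> layer d k"
proof -
  have "PIdl (p [^] Suc k) \<subseteq> PIdl (p [^] k)"
    by (rule cgenideal_minimal[OF ideal_pow])
       (use ideal.I_l_closed[OF ideal_pow[of k] cgenideal_self] in \<open>auto simp: m_comm\<close>)
  then show ?thesis unfolding layer_def by (intro PiE_mono) auto
qed

lemma layer_subset_vecs: "layer d k \<subseteq> vecs S d"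
  unfolding layer_def vecs_def
  by (intro PiE_mono) (use ideal.Icarr[OF ideal_pow] in auto)

lemma finite_layer: "finite (layer d k)"
  by (rule finite_subset[OF layer_subset_vecs])
     (simp add: vecs_def finite_PiE finite_carrier)

lemma card_layer: "k \<le> n \<Longrightarrow> card (layer d k) = q ^ (d * (n - k))"
  by (simp add: layer_def card_PiE card_cgenideal_pow power_mult[symmetric] mult.commute)

text \<open>
  Choose an entry \<open>x i\<close> outside \<open>p^(k+1) S\<close>; it divides \<open>p^k\<close>, and hence everything in \<open>p^k S\<close>.
  So a target vector \<open>y\<close> over \<open>p^k S\<close> is \<open>x i\<close> times a vector \<open>z\<close>, and the matrix with \<open>z\<close> as
  row \<open>i\<close> and zeros elsewhere maps \<open>x\<close> to \<open>y\<close>. Its trace is \<open>z i\<close>, which is cancelled by the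
  entry \<open>- z i\<close> at a second diagonal place \<open>(j, j)\<close>. This changes coordinate \<open>j\<close> of the product
  by a multiple of \<open>x j\<close>, thus of \<open>x i\<close>, and the entry at \<open>(i, j)\<close> can compensate for that.
\<close>

lemma row_mult_image:
  assumes d: "d > 1" and M: "sl_mats S d \<subseteq> M" "M \<subseteq> gl_mats S d"
    and x: "x \<in> layer d k" "x \<notin> layer d (Suc k)"
  shows "row_mult S d x ` M = layer d k"
proof
  interpret I: ideal "PIdl (p [^] k)" S by (rule ideal_pow)
  have xI: "x r \<in> PIdl (p [^] k)" if "r < d" for r
    using x that by (auto simp: layer_def)
  have xc [simp]: "x r \<in> carrier S" if "r < d" for r
    using xI that I.Icarr by blast
  show "row_mult S d x ` M \<subseteq> layer d k"
  proof (rule image_subsetI)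
    fix a assume "a \<in> M"
    then have "a (r, m) \<in> carrier S" if "r < d" "m < d" for r m
      using M that by (auto simp: gl_mats_def)
    moreover have "(\<Oplus>r\<in>A. f r) \<in> PIdl (p [^] k)"
      if "finite A" "f \<in> A \<rightarrow> PIdl (p [^] k)" for A and f :: "nat \<Rightarrow> 'a"
      using that by (induction A rule: finite_induct) (auto simp: Pi_iff I.Icarr finsum_insert)
    ultimately show "row_mult S d x a \<in> layer d k"
      using xI unfolding row_mult_def layer_def
      by (auto simp: Pi_iff I.I_r_closed)
  qed
  obtain i where i: "i < d" "x i \<notin> PIdl (p [^] Suc k)"
    using x by (auto simp: layer_def PiE_iff)
  obtain j where j: "j < d" "j \<noteq> i"
    using d i by (intro that[of "if i = 0 then 1 else 0"]) auto
  interpret X: ideal "PIdl (x i)" S using i by (simp add: cgenideal_ideal)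
  have sub: "PIdl (p [^] k) \<subseteq> PIdl (x i)"
    using pow_in_cgenideal[of "x i" k] i by (intro cgenideal_minimal X.ideal_axioms) auto
  have dvd: "\<exists>z\<in>carrier S. w = x i \<otimes> z" if "w \<in> PIdl (p [^] k)" for w
  proof -
    have "w \<in> PIdl (x i)" using sub that by blast
    then obtain z where z: "z \<in> carrier S" "w = z \<otimes> x i" unfolding cgenideal_def by blast
    then have "w = x i \<otimes> z" using m_comm i by simp
    then show ?thesis using z(1) by blast
  qed
  show "layer d k \<subseteq> row_mult S d x ` M"
  proof
    fix y assume y: "y \<in> layer d k"
    then have "\<forall>m\<in>{..<d}. \<exists>z\<in>carrier S. y m = x i \<otimes> z"
      by (intro ballI dvd) (auto simp: layer_def)
    then obtain z where z: "\<And>m. m < d \<Longrightarrow> z m \<in> carrier S" "\<And>m. m < d \<Longrightarrow> y m = x i \<otimes> z m"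
      by (metis lessThan_iff)
    obtain s where s: "s \<in> carrier S" "x j \<otimes> z i = x i \<otimes> s"
      using dvd[OF I.I_r_closed[OF xI]] i j z by blast
    \<comment> \<open>\<open>s\<close> compensates for the effect of the entry \<open>- z i\<close> on coordinate \<open>j\<close>\<close>
    define a where "a = (\<lambda>(r, m)\<in>{..<d} \<times> {..<d}.
      if r = i then (if m = j then z m \<oplus> s else z m)
      else if r = j \<and> m = j then \<ominus> z i else \<zero>)"
    have "a \<in> gl_mats S d"
      using z s i j by (auto simp: a_def gl_mats_def)
    moreover have "mat_trace S d a = \<zero>"
    proof -
      have "mat_trace S d a = a (i, i) \<oplus> a (j, j)"
        unfolding mat_trace_def using i j z by (intro finsum_two) (auto simp: a_def)
      then show ?thesis using i j z by (simp add: a_def r_neg)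
    qed
    ultimately have "a \<in> M" using M by (auto simp: sl_mats_def)
    moreover have "row_mult S d x a = y"
    proof
      fix m
      show "row_mult S d x a m = y m"
      proof (cases "m < d")
        case True
        have "(\<Oplus>r\<in>{..<d}. x r \<otimes> a (r, m)) = x i \<otimes> a (i, m) \<oplus> x j \<otimes> a (j, m)"
          using True i j z s by (intro finsum_two) (auto simp: a_def)
        then have "row_mult S d x a m = x i \<otimes> a (i, m) \<oplus> x j \<otimes> a (j, m)"
          using True by (simp add: row_mult_def)
        also have "\<dots> = y m"
        proof (cases "m = j")
          case True
          have "x i \<otimes> (z j \<oplus> s) \<oplus> x j \<otimes> (\<ominus> z i) = x i \<otimes> z j \<oplus> x i \<otimes> s \<oplus> \<ominus> (x i \<otimes> s)"
            using i j z s(1) by (simp add: r_distr r_minus s(2)[symmetric])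
          also have "\<dots> = x i \<otimes> z j"
            using i j z s(1) by (simp add: a_assoc r_neg)
          finally show ?thesis
            using True i j z by (simp add: a_def)
        qed (use \<open>m < d\<close> i j z in \<open>simp add: a_def\<close>)
        finally show ?thesis .
      next
        case False
        then show ?thesis using y by (auto simp: row_mult_def layer_def PiE_def extensional_def)
      qed
    qed
    ultimately show "y \<in> row_mult S d x ` M" by blast
  qed
qed

context
  fixes d :: nat and M :: "(nat \<times> nat \<Rightarrow> 'a) set"
  assumes d: "d > 1" and sgM: "subgroup M (mat_group S d)" and slM: "sl_mats S d \<subseteq> M"
begin

lemma M_subset_gl: "M \<subseteq> gl_mats S d"
  using subgroup.subset[OF sgM] by (simp add: gl_mats_def)

lemma finite_M: "finite M"
  by (rule finite_subset[OF M_subset_gl]) (simp add: gl_mats_def finite_PiE finite_carrier)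

lemma card_M_pos: "card M > 0"
  using finite_M subgroup.one_closed[OF sgM] by (auto simp: card_gt_0_iff)

lemma card_annihilators:
  assumes "x \<in> layer d k" "x \<notin> layer d (Suc k)"
  shows "card {a \<in> M. x \<in> row_kernel S d a} * card (layer d k) = card M"
proof -
  have x: "x \<in> vecs S d" using assms layer_subset_vecs by blast
  interpret G: group_hom "mat_group S d" "vec_group S d" "row_mult S d x"
    using group_mat_group group_vec_group row_mult_hom[OF x]
    by (simp add: group_hom_def group_hom_axioms_def)
  interpret H: group_hom "mat_group S d\<lparr>carrier := M\<rparr>" "vec_group S d" "row_mult S d x"
    by (rule G.induced_group_hom'[OF sgM])
  have "kernel (mat_group S d\<lparr>carrier := M\<rparr>) (vec_group S d) (row_mult S d x)
      = {a \<in> M. x \<in> row_kernel S d a}"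
    using x by (simp add: kernel_def row_kernel_def)
  then show ?thesis
    using H.card_kernel_times_card_image row_mult_image[OF d slM M_subset_gl assms]
    by (simp add: order_def)
qed

text \<open>
  Each step from \<open>layer d (Suc k)\<close> up to \<open>layer d k\<close> adds \<open>1 - q^(-d)\<close> to the sum of the
  proportions: all new vectors have annihilators of the same size, by \<open>card_annihilators\<close>. The
  last layer consists of the zero vector, which every matrix annihilates.
\<close>

lemma sum_card_annihilators_layer:
  assumes "k + m = n"
  shows "(\<Sum>x\<in>layer d k. rat_of_nat (card {a \<in> M. x \<in> row_kernel S d a}))
    = of_nat (card M) * (1 + of_nat m * (1 - 1 / of_nat q ^ d))"
  using assms
proof (induction m arbitrary: k)
  case 0
  let ?o = "\<lambda>i\<in>{..<d}. \<zero>"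
  have "?o \<in> layer d n"
    using additive_subgroup.zero_closed[OF ideal.axioms(1)[OF ideal_pow]] by (auto simp: layer_def)
  moreover have "card (layer d n) = 1" by (simp add: card_layer)
  ultimately have L: "layer d n = {?o}" by (metis card_1_singletonE singletonD)
  have "?o \<in> row_kernel S d a" if "a \<in> M" for a
  proof -
    have "(\<Oplus>i\<in>{..<d}. ?o i \<otimes> a (i, j)) = \<zero>" if "j < d" for j
    proof (rule add.finprod_one_eqI)
      fix i assume "i \<in> {..<d}"
      then show "?o i \<otimes> a (i, j) = \<zero>"
        using \<open>a \<in> M\<close> M_subset_gl that by (force simp: gl_mats_def PiE_iff intro!: l_null)
    qed
    then show ?thesis by (auto simp: row_kernel_def vecs_def row_mult_def fun_eq_iff)
  qed
  then have "{a \<in> M. ?o \<in> row_kernel S d a} = M" by blast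
  then show ?case using 0 L by (simp del: restrict_apply)
next
  case (Suc m)
  let ?f = "\<lambda>x. rat_of_nat (card {a \<in> M. x \<in> row_kernel S d a})"
  have k: "k \<le> n" "n - k = Suc m" "Suc k \<le> n" "n - Suc k = m" using Suc.prems by auto
  have q: "of_nat q \<noteq> (0::rat)" using q_pos by simp
  have cL: "of_nat (card (layer d k)) = (of_nat q ^ d * of_nat q ^ (d * m) :: rat)"
    and cL': "of_nat (card (layer d (Suc k))) = (of_nat q ^ (d * m) :: rat)"
    using k by (simp_all add: card_layer power_add)
  have "(\<Sum>x\<in>layer d k - layer d (Suc k). ?f x)
      = (\<Sum>x\<in>layer d k - layer d (Suc k). of_nat (card M) / of_nat (card (layer d k)))"
  proof (rule sum.cong)
    fix x assume x: "x \<in> layer d k - layer d (Suc k)"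
    have "?f x * of_nat (card (layer d k)) = of_nat (card M)"
      using card_annihilators[of x k] x by (simp flip: of_nat_mult)
    then show "?f x = of_nat (card M) / of_nat (card (layer d k))"
      using q cL by (simp add: field_simps)
  qed simp
  also have "\<dots> = (of_nat (card (layer d k)) - of_nat (card (layer d (Suc k))))
      * (of_nat (card M) / of_nat (card (layer d k)))"
    using layer_Suc_subset finite_layer
    by (simp add: card_Diff_subset of_nat_diff card_mono)
  also have "\<dots> = of_nat (card M) * (1 - 1 / of_nat q ^ d)"
    unfolding cL cL' using q by (simp add: field_simps)
  finally have diff: "(\<Sum>x\<in>layer d k - layer d (Suc k). ?f x)
      = of_nat (card M) * (1 - 1 / of_nat q ^ d)" .
  have "(\<Sum>x\<in>layer d k. ?f x)
      = (\<Sum>x\<in>layer d k - layer d (Suc k). ?f x) + (\<Sum>x\<in>layer d (Suc k). ?f x)"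
    by (rule sum.subset_diff[OF layer_Suc_subset finite_layer])
  also have "\<dots> = of_nat (card M) * (1 - 1 / of_nat q ^ d)
      + of_nat (card M) * (1 + of_nat m * (1 - 1 / of_nat q ^ d))"
    using Suc.IH[of "Suc k"] Suc.prems by (simp only: diff add_Suc add_Suc_right)
  also have "\<dots> = of_nat (card M) * (1 + of_nat (Suc m) * (1 - 1 / of_nat q ^ d))"
    by (simp add: algebra_simps add_divide_distrib)
  finally show ?case .
qed

text \<open>Count the pairs \<open>(x, a)\<close> with \<open>x a = 0\<close> in both orders.\<close>

theorem average_card_row_kernel:
  "(\<Sum>a\<in>M. rat_of_nat (card (row_kernel S d a))) / of_nat (card M)
    = 1 + of_nat n * (1 - 1 / of_nat q ^ d)"
proof -
  have "(\<Sum>a\<in>M. card (row_kernel S d a)) = (\<Sum>a\<in>M. \<Sum>x | x \<in> vecs S d \<and> x \<in> row_kernel S d a. 1)"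
    by (intro sum.cong) (auto simp: row_kernel_def intro!: arg_cong[where f = card])
  also have "\<dots> = (\<Sum>x\<in>vecs S d. \<Sum>a | a \<in> M \<and> x \<in> row_kernel S d a. 1)"
    using finite_layer[of d 0] by (intro sum.swap_restrict finite_M) (simp add: layer_0)
  finally have "(\<Sum>a\<in>M. rat_of_nat (card (row_kernel S d a)))
      = (\<Sum>x\<in>layer d 0. rat_of_nat (card {a \<in> M. x \<in> row_kernel S d a}))"
    by (simp add: layer_0 flip: of_nat_sum)
  then show ?thesis
    using sum_card_annihilators_layer[of 0 n] card_M_pos by simp
qed

end

end

section \<open>Truncations of a domain with a uniformizer\<close>

lemma one_plus_linear_fps:
  fixes c :: "'c::field"
  shows "Abs_fps (\<lambda>n. 1 + of_nat n * (1 - c)) = (1 - fps_const c * fps_X) / (1 - fps_X)\<^sup>2"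
proof -
  let ?F = "Abs_fps (\<lambda>n. 1 + of_nat n * (1 - c))"
  have "?F * (1 - fps_X)\<^sup>2 = ?F - 2 * (fps_X * ?F) + fps_X * (fps_X * ?F)"
    by (simp add: power2_eq_square algebra_simps)
  also have "\<dots> = 1 - fps_const c * fps_X"
  proof (rule fps_ext)
    fix n :: nat
    show "fps_nth (?F - 2 * (fps_X * ?F) + fps_X * (fps_X * ?F)) n = fps_nth (1 - fps_const c * fps_X) n"
      by (cases n; cases "n - 1") (auto simp: numeral_fps_const fps_X_mult_nth algebra_simps)
  qed
  finally have *: "?F * (1 - fps_X)\<^sup>2 = 1 - fps_const c * fps_X" .
  have "fps_nth (1 - fps_X :: 'c fps) 0 \<noteq> 0" by simp
  then have "(1 - fps_X :: 'c fps)\<^sup>2 \<noteq> 0" by (metis fps_zero_nth power_eq_0_iff)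
  then show ?thesis unfolding *[symmetric] by simp
qed

text \<open>
  A discrete valuation ring with finite residue field, as far as it matters for the truncations:
  the valuation enters only through the comparability of every element with the powers of the
  uniformizer \<open>p\<close>.
\<close>

locale uniformized_domain = domain R for R :: "('a, 'b) ring_scheme" (structure) +
  fixes p :: 'a
  assumes p_closed [simp, intro]: "p \<in> carrier R"
    and p_nonzero: "p \<noteq> \<zero>"
    and pow_in_cgenideal:
      "\<lbrakk>x \<in> carrier R; x \<notin> PIdl (p [^] Suc k)\<rbrakk> \<Longrightarrow> p [^] k \<in> PIdl x"
    and finite_residue_ring: "finite (carrier (R Quot PIdl p))"
begin

lemma ideal_pow: "ideal (PIdl (p [^] (k::nat))) R"
  by (simp add: cgenideal_ideal)

lemma trunc_ideal_eq: "trunc_ideal R (PIdl p) n = PIdl (p [^] n)"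
proof (induction n)
  case 0
  then show ?case
    by (simp add: trunc_ideal_def nat_pow_def ideals_set_def cgenideal_one)
next
  case (Suc n)
  have "ideal_prod R (PIdl (p [^] n)) (PIdl p) = Idl (PIdl (p [^] n \<otimes> p))"
    by (simp add: ideal_prod_eq_genideal cgenideal_ideal cgenideal_prod)
  also have "\<dots> = PIdl (p [^] n \<otimes> p)"
    using cgenideal_ideal[of "p [^] n \<otimes> p"]
    by (intro equalityI genideal_minimal genideal_self) (auto intro: ideal.Icarr)
  finally show ?case
    using Suc by (simp add: trunc_ideal_def nat_pow_def ideals_set_def)
qed

lemma pow_nonzero: "p [^] (k::nat) \<noteq> \<zero>"
  by (induction k) (use p_nonzero integral_iff in auto)

text \<open>
  Cancellation of powers of \<open>p\<close>. By this, multiplication by \<open>p^k\<close> identifies \<open>R / p^(n-k) R\<close>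
  with the ideal generated by \<open>p^k\<close> in \<open>R / p^n R\<close>, which is how the sizes of the ideals are
  found below.
\<close>

lemma pow_mult_mem_iff:
  fixes k m :: nat
  assumes "x \<in> carrier R"
  shows "p [^] k \<otimes> x \<in> PIdl (p [^] (k + m)) \<longleftrightarrow> x \<in> PIdl (p [^] m)"
proof -
  have "c \<otimes> p [^] (k + m) = p [^] k \<otimes> (c \<otimes> p [^] m)" if "c \<in> carrier R" for c
    using that by (simp add: nat_pow_mult[symmetric] m_lcomm)
  then show ?thesis
    using assms pow_nonzero[of k]
    by (simp add: cgenideal_eq_image image_iff m_lcancel cong: bex_cong)
qed

abbreviation proj :: "nat \<Rightarrow> 'a \<Rightarrow> 'a set"
  where "proj n \<equiv> (+>) (PIdl (p [^] n))"

abbreviation trunc :: "nat \<Rightarrow> 'a set ring"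
  where "trunc n \<equiv> R Quot PIdl (p [^] n)"

lemma proj_hom: "ring_hom_cring R (trunc n) (proj n)"
  by (rule ideal.rcos_ring_hom_cring[OF ideal_pow is_cring])

lemma carrier_trunc: "carrier (trunc n) = proj n ` carrier R"
  by (auto simp: FactRing_def A_RCOSETS_def')

lemma proj_eq_iff:
  assumes "x \<in> carrier R" "y \<in> carrier R"
  shows "proj n x = proj n y \<longleftrightarrow> x \<ominus> y \<in> PIdl (p [^] n)"
  using quotient_eq_iff_same_a_r_cos[OF ideal_pow assms] by simp

lemma proj_pow: "proj n p [^]\<^bsub>trunc n\<^esub> (k::nat) = proj n (p [^] k)"
proof -
  interpret ring_hom_cring R "trunc n" "proj n" by (rule proj_hom)
  show ?thesis by (simp add: hom_nat_pow)
qed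

lemma cgenideal_proj:
  assumes "y \<in> carrier R"
  shows "PIdl\<^bsub>trunc n\<^esub> (proj n y) = (\<lambda>x. proj n (x \<otimes> y)) ` carrier R"
proof -
  interpret ring_hom_cring R "trunc n" "proj n" by (rule proj_hom)
  show ?thesis
    unfolding cgenideal_eq_image[of "trunc n"] carrier_trunc image_image
    using assms by (intro image_cong) auto
qed

lemma proj_pow_mult_eq_iff:
  assumes "x \<in> carrier R" "y \<in> carrier R" "k \<le> n"
  shows "proj n (x \<otimes> p [^] k) = proj n (y \<otimes> p [^] k) \<longleftrightarrow> proj (n - k) x = proj (n - k) y"
proof -
  have "x \<otimes> p [^] k \<ominus> y \<otimes> p [^] k = p [^] k \<otimes> (x \<ominus> y)"
    using assms by (simp add: minus_eq r_distr r_minus m_comm[of _ "p [^] k"])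
  then show ?thesis
    using assms pow_mult_mem_iff[of "x \<ominus> y" k "n - k"] by (simp add: proj_eq_iff)
qed

lemma card_cgenideal_proj_pow:
  assumes "k \<le> n"
  shows "card (PIdl\<^bsub>trunc n\<^esub> (proj n p [^]\<^bsub>trunc n\<^esub> k)) = card (carrier (trunc (n - k)))"
  unfolding proj_pow cgenideal_proj[OF nat_pow_closed[OF p_closed]] carrier_trunc
  by (rule card_image_eq_if_same_fibres) (use assms proj_pow_mult_eq_iff in simp)

lemma proj_mem_cgenideal:
  assumes "x \<in> carrier R" "y \<in> carrier R" "x \<in> PIdl y"
  shows "proj n x \<in> PIdl\<^bsub>trunc n\<^esub> (proj n y)"
  unfolding cgenideal_proj[OF assms(2)] using assms(3) by (auto simp: cgenideal_def)

text \<open>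
  Multiplication by \<open>p^n\<close> on \<open>R / p^(n+1) R\<close> has the ideal generated by \<open>p^n\<close> as image and the
  ideal generated by \<open>p\<close> as kernel. These are as large as \<open>R / p R\<close> and \<open>R / p^n R\<close>,
  respectively, so the size grows by the factor \<open>q\<close> from each \<open>n\<close> to the next.
\<close>

lemma card_trunc: "card (carrier (trunc n)) = card (carrier (R Quot PIdl p)) ^ n"
proof (induction n)
  case 0
  have "proj 0 x = proj 0 \<zero>" if "x \<in> carrier R" for x
  proof -
    have "x \<ominus> \<zero> \<in> PIdl (p [^] (0::nat))"
      using that by (simp add: cgenideal_one)
    then show ?thesis
      using proj_eq_iff[OF that zero_closed] by blast
  qed
  then have "carrier (trunc 0) = {proj 0 \<zero>}" unfolding carrier_trunc by blast
  then show ?case by simp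
next
  case (Suc n)
  \<comment> \<open>naming \<open>Suc n\<close> prevents the simplifier from expanding the power in \<open>trunc (Suc n)\<close>\<close>
  define m where "m = Suc n"
  have m: "n \<le> m" "1 \<le> m" "m - n = 1" "m - 1 = n"
    by (simp_all add: m_def)
  interpret Q: ring_hom_cring R "trunc m" "proj m" by (rule proj_hom)
  define h where "h x = x \<otimes>\<^bsub>trunc m\<^esub> proj m (p [^] n)" for x
  interpret h: group_hom "add_monoid (trunc m)" "add_monoid (trunc m)" h
  proof (intro group_hom.intro group_hom_axioms.intro Q.S.a_group)
    show "h \<in> hom (add_monoid (trunc m)) (add_monoid (trunc m))"
      unfolding h_def by (rule Q.S.r_mult_hom_add_monoid) simp
  qed
  have h_proj: "h (proj m x) = proj m (x \<otimes> p [^] n)" if "x \<in> carrier R" for x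
    using that by (simp add: h_def)
  have image: "h ` carrier (trunc m) = PIdl\<^bsub>trunc m\<^esub> (proj m p [^]\<^bsub>trunc m\<^esub> n)"
    unfolding proj_pow cgenideal_proj[OF nat_pow_closed[OF p_closed]] carrier_trunc
    unfolding image_image using h_proj by (intro image_cong) auto
  have kernel: "kernel (add_monoid (trunc m)) (add_monoid (trunc m)) h
      = PIdl\<^bsub>trunc m\<^esub> (proj m p [^]\<^bsub>trunc m\<^esub> (1::nat))"
  proof -
    have iff: "h (proj m x) = \<zero>\<^bsub>trunc m\<^esub> \<longleftrightarrow> x \<in> PIdl p" if "x \<in> carrier R" for x
    proof -
      have "h (proj m x) = \<zero>\<^bsub>trunc m\<^esub> \<longleftrightarrow> proj m (x \<otimes> p [^] n) = proj m (\<zero> \<otimes> p [^] n)"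
        using that by (simp add: h_proj del: Q.hom_mult)
      also have "\<dots> \<longleftrightarrow> x \<in> PIdl p"
        using that m proj_pow_mult_eq_iff[of x \<zero> n m] proj_eq_iff[of x \<zero> 1]
        by (simp add: minus_eq)
      finally show ?thesis .
    qed
    have p1: "proj m p [^]\<^bsub>trunc m\<^esub> (1::nat) = proj m p" by simp
    have "kernel (add_monoid (trunc m)) (add_monoid (trunc m)) h = proj m ` (PIdl p)"
      using iff ideal.Icarr[OF cgenideal_ideal[OF p_closed]]
      by (auto simp: kernel_def carrier_trunc)
    then show ?thesis
      unfolding p1 cgenideal_proj[OF p_closed] by (simp add: cgenideal_eq_image image_image)
  qed
  have "card (carrier (trunc n)) * card (carrier (R Quot PIdl p)) = card (carrier (trunc m))"
  proof -
    have "card (kernel (add_monoid (trunc m)) (add_monoid (trunc m)) h) = card (carrier (trunc n))"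
      unfolding kernel using card_cgenideal_proj_pow[OF m(2)] unfolding m(4) .
    moreover have "card (h ` carrier (add_monoid (trunc m))) = card (carrier (R Quot PIdl p))"
      using card_cgenideal_proj_pow[OF m(1)] by (simp add: image m)
    ultimately show ?thesis
      using h.card_kernel_times_card_image by (simp only: order_def) simp
  qed
  then show ?case
    using Suc by (simp only: m_def power_Suc2)
qed

lemma card_residue_ring_pos: "card (carrier (R Quot PIdl p)) > 0"
  using finite_residue_ring carrier_trunc[of 1] by (auto simp: card_gt_0_iff)

lemma finite_chain_ring_trunc:
  "finite_chain_ring (trunc n) (proj n p) n (card (carrier (R Quot PIdl p)))"
proof -
  interpret Q: ring_hom_cring R "trunc n" "proj n" by (rule proj_hom)
  show ?thesis
  proof
    fix x k
    assume "x \<in> carrier (trunc n)"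
      and nx: "x \<notin> PIdl\<^bsub>trunc n\<^esub> (proj n p [^]\<^bsub>trunc n\<^esub> Suc k)"
    then obtain y where y: "y \<in> carrier R" "x = proj n y" by (auto simp: carrier_trunc)
    then have "y \<notin> PIdl (p [^] Suc k)"
      using nx proj_mem_cgenideal[of y "p [^] Suc k" n] unfolding proj_pow by auto
    then show "proj n p [^]\<^bsub>trunc n\<^esub> k \<in> PIdl\<^bsub>trunc n\<^esub> x"
      using pow_in_cgenideal[of y k] proj_mem_cgenideal[of "p [^] k" y n] y
      unfolding proj_pow by auto
  qed (auto simp: card_residue_ring_pos card_cgenideal_proj_pow card_trunc)
qed

lemma mat_trace_reduce_mat:
  assumes "a \<in> gl_mats R d"
  shows "mat_trace (trunc n) d (reduce_mat R (PIdl p) d n a) = proj n (mat_trace R d a)"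
proof -
  interpret Q: ring_hom_cring R "trunc n" "proj n" by (rule proj_hom)
  have a: "a (i, i) \<in> carrier R" if "i < d" for i
    using assms that by (auto simp: gl_mats_def)
  have "proj n (mat_trace R d a) = (\<Oplus>\<^bsub>trunc n\<^esub>i\<in>{..<d}. proj n (a (i, i)))"
    unfolding mat_trace_def using a by (subst Q.hom_finsum) (auto simp: comp_def)
  also have "\<dots> = mat_trace (trunc n) d (reduce_mat R (PIdl p) d n a)"
    unfolding mat_trace_def using a
    by (intro Q.S.finsum_cong') (auto simp: reduce_mat_def trunc_ideal_eq)
  finally show ?thesis by simp
qed

lemma reduce_mat_gl_mats: "reduce_mat R (PIdl p) d n ` gl_mats R d = gl_mats (trunc n) d"
proof
  show "reduce_mat R (PIdl p) d n ` gl_mats R d \<subseteq> gl_mats (trunc n) d"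
    by (auto simp: reduce_mat_def gl_mats_def trunc_ideal_eq carrier_trunc)
  show "gl_mats (trunc n) d \<subseteq> reduce_mat R (PIdl p) d n ` gl_mats R d"
  proof
    fix b assume b: "b \<in> gl_mats (trunc n) d"
    then have "\<forall>ij\<in>{..<d} \<times> {..<d}. \<exists>y\<in>carrier R. b ij = proj n y"
      by (auto simp: gl_mats_def carrier_trunc PiE_iff image_iff)
    then obtain a where a: "\<And>ij. ij \<in> {..<d} \<times> {..<d} \<Longrightarrow> a ij \<in> carrier R \<and> b ij = proj n (a ij)"
      by metis
    have "restrict a ({..<d} \<times> {..<d}) \<in> gl_mats R d"
      using a by (auto simp: gl_mats_def)
    moreover have "b = reduce_mat R (PIdl p) d n (restrict a ({..<d} \<times> {..<d}))"
      using a b by (auto simp: reduce_mat_def trunc_ideal_eq gl_mats_def fun_eq_iff PiE_def extensional_def)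
    ultimately show "b \<in> reduce_mat R (PIdl p) d n ` gl_mats R d" by blast
  qed
qed

text \<open>
  A trace that vanishes modulo \<open>p^n\<close> need not vanish: a lift of a matrix of trace zero gets trace
  zero by subtracting its trace, which is a multiple of \<open>p^n\<close>, from the entry at \<open>(0, 0)\<close>.
\<close>

lemma reduce_mat_sl_mats:
  assumes "d > 0"
  shows "reduce_mat R (PIdl p) d n ` sl_mats R d = sl_mats (trunc n) d"
proof
  interpret Q: ring_hom_cring R "trunc n" "proj n" by (rule proj_hom)
  show "reduce_mat R (PIdl p) d n ` sl_mats R d \<subseteq> sl_mats (trunc n) d"
    using reduce_mat_gl_mats[of d n] mat_trace_reduce_mat[of _ d n]
    by (auto simp: sl_mats_def)
  show "sl_mats (trunc n) d \<subseteq> reduce_mat R (PIdl p) d n ` sl_mats R d"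
  proof
    fix b assume b: "b \<in> sl_mats (trunc n) d"
    then obtain a where a: "a \<in> gl_mats R d" "b = reduce_mat R (PIdl p) d n a"
      using reduce_mat_gl_mats[of d n] by (auto simp: sl_mats_def)
    define t where "t = mat_trace R d a"
    have ac: "a ij \<in> carrier R" if "ij \<in> {..<d} \<times> {..<d}" for ij
      using a that by (auto simp: gl_mats_def)
    have tc: "t \<in> carrier R"
      unfolding t_def mat_trace_def using ac by (intro finsum_closed) auto
    have "proj n t = \<zero>\<^bsub>trunc n\<^esub>"
      using b a mat_trace_reduce_mat[of a d n] by (simp add: sl_mats_def t_def)
    then have tz: "proj n (a (0, 0) \<ominus> t) = proj n (a (0, 0))"
      using ac[of "(0, 0)"] assms tc by (simp add: minus_eq)
    define a' where "a' = a((0, 0) := a (0, 0) \<ominus> t)"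
    have a': "a' \<in> gl_mats R d"
      using a(1) ac assms tc by (auto simp: a'_def gl_mats_def PiE_def extensional_def)
    have "mat_trace R d a' = (\<Oplus>i\<in>{..<d}. a (i, i) \<oplus> (if 0 = i then \<ominus> t else \<zero>))"
      unfolding mat_trace_def using ac tc assms
      by (intro finsum_cong') (auto simp: a'_def minus_eq)
    also have "\<dots> = t \<oplus> (\<Oplus>i\<in>{..<d}. if 0 = i then \<ominus> t else \<zero>)"
      unfolding t_def mat_trace_def using ac tc by (intro finsum_addf) (auto simp: t_def mat_trace_def)
    also have "(\<Oplus>i\<in>{..<d}. if 0 = i then \<ominus> t else \<zero>) = \<ominus> t"
      using assms tc add.finprod_singleton[of 0 "{..<d}" "\<lambda>_. \<ominus> t"] by auto
    finally have "a' \<in> sl_mats R d" using a' tc by (simp add: sl_mats_def r_neg)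
    moreover have "b = reduce_mat R (PIdl p) d n a'"
      using a tz by (auto simp: reduce_mat_def trunc_ideal_eq a'_def fun_eq_iff)
    ultimately show "b \<in> reduce_mat R (PIdl p) d n ` sl_mats R d" by blast
  qed
qed

theorem ask_zeta_eq:
  assumes d: "d > 1" and M: "M = sl_mats R d \<or> M = gl_mats R d"
  shows "ask_zeta R (PIdl p) d M
    = (1 - fps_const (1 / of_nat (card (carrier (R Quot PIdl p))) ^ d) * fps_X) / (1 - fps_X)\<^sup>2"
proof -
  have "(\<Sum>a\<in>N. rat_of_nat (card (row_kernel (trunc_ring R (PIdl p) n) d a))) / of_nat (card N)
      = 1 + of_nat n * (1 - 1 / of_nat (card (carrier (R Quot PIdl p))) ^ d)"
    if N: "N = reduce_mat R (PIdl p) d n ` M" for n N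
  proof -
    interpret C: finite_chain_ring "trunc n" "proj n p" n "card (carrier (R Quot PIdl p))"
      by (rule finite_chain_ring_trunc)
    have "N = sl_mats (trunc n) d \<or> N = gl_mats (trunc n) d"
      using M reduce_mat_sl_mats[of d n] reduce_mat_gl_mats[of d n] d unfolding N by fastforce
    then have "subgroup N (mat_group (trunc n) d)" "sl_mats (trunc n) d \<subseteq> N"
      using C.subgroup_sl_mats[of d] C.subgroup_gl_mats[of d] by (auto simp: sl_mats_def)
    from C.average_card_row_kernel[OF d this] show ?thesis
      by (simp add: trunc_ring_def trunc_ideal_eq)
  qed
  then show ?thesis
    unfolding one_plus_linear_fps[symmetric] ask_zeta_def by (simp add: Let_def)
qed

end

section \<open>Valuation rings of non-Archimedean local fields\<close>

context nonarch_local_field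
begin

lemma cgenideal_valuation_ring:
  assumes y: "y \<in> carrier (valuation_ring K v)" "y \<noteq> \<zero>"
  shows "PIdl\<^bsub>valuation_ring K v\<^esub> y = {x \<in> carrier K. val_ge K v (v y) x}"
proof
  have yK: "y \<in> carrier K - {\<zero>}" using y by (auto simp: valuation_ring_def)
  show "PIdl\<^bsub>valuation_ring K v\<^esub> y \<subseteq> {x \<in> carrier K. val_ge K v (v y) x}"
    using yK val_ge_mult[of _ y 0 "v y"]
    by (auto simp: cgenideal_def valuation_ring_def val_ge_def[of K v "v y" y])
  show "{x \<in> carrier K. val_ge K v (v y) x} \<subseteq> PIdl\<^bsub>valuation_ring K v\<^esub> y"
  proof
    fix x assume x: "x \<in> {x \<in> carrier K. val_ge K v (v y) x}"
    have i: "inv y \<in> carrier K - {\<zero>}" "inv y \<otimes> y = \<one>" using yK field_Units by auto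
    then have "v (inv y) = - v y" using val_mult[of "inv y" y] yK val_one by simp
    then have "val_ge K v 0 (x \<otimes> inv y)"
      using val_ge_mult[of x "inv y" "v y" "- v y"] x i by (auto simp: val_ge_def)
    moreover have "x = (x \<otimes> inv y) \<otimes> y" using x i yK by (simp add: m_assoc)
    ultimately show "x \<in> PIdl\<^bsub>valuation_ring K v\<^esub> y"
      using x i unfolding cgenideal_def valuation_ring_def by auto
  qed
qed

text \<open>
  Any element \<open>p\<close> of value \<open>1\<close> works, because divisibility in the valuation ring is comparison of
  values: an element that \<open>p^(k+1)\<close> does not divide has value at most \<open>k\<close>, so it divides \<open>p^k\<close>.
\<close>

lemma uniformizer_exists:
  obtains p where "uniformized_domain (valuation_ring K v) p"
    "PIdl\<^bsub>valuation_ring K v\<^esub> p = valuation_ideal K v"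
proof -
  let ?R = "valuation_ring K v"
  interpret R: domain ?R by (rule valuation_ring_is_domain)
  obtain p where p: "p \<in> carrier K" "p \<noteq> \<zero>" "v p = 1"
    using val_surj by (metis (no_types, lifting) Diff_iff UNIV_I imageE singletonI)
  have pR: "p \<in> carrier ?R" using p by (auto simp: valuation_ring_def val_ge_def)
  have P: "PIdl\<^bsub>?R\<^esub> p = valuation_ideal K v"
    using cgenideal_valuation_ring[OF pR p(2)] p by (simp add: valuation_ideal_def)
  have pow: "p [^]\<^bsub>?R\<^esub> k \<in> carrier ?R \<and> p [^]\<^bsub>?R\<^esub> k \<noteq> \<zero> \<and> v (p [^]\<^bsub>?R\<^esub> k) = int k" for k :: nat
  proof (induction k)
    case 0
    show ?case using R.one_closed by (simp add: val_one valuation_ring_def)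
  next
    case (Suc k)
    then have q: "p [^]\<^bsub>?R\<^esub> k \<in> carrier K - {\<zero>}" by (auto simp: valuation_ring_def)
    have "p [^]\<^bsub>?R\<^esub> Suc k = p [^]\<^bsub>?R\<^esub> k \<otimes> p" by (simp add: valuation_ring_def)
    then show ?case
      using Suc q p pR val_mult[OF q, of p] R.nat_pow_closed[OF pR, of "Suc k"] integral_iff by auto
  qed
  have "uniformized_domain ?R p"
  proof
    show "p \<in> carrier ?R" by (rule pR)
    show "p \<noteq> \<zero>\<^bsub>?R\<^esub>" using p by (simp add: valuation_ring_def)
    show "finite (carrier (?R Quot PIdl\<^bsub>?R\<^esub> p))" using P finite_residue_field by simp
    fix x and k :: nat assume x: "x \<in> carrier ?R" "x \<notin> PIdl\<^bsub>?R\<^esub> (p [^]\<^bsub>?R\<^esub> Suc k)"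
    then have "x \<in> carrier K" "\<not> val_ge K v (int (Suc k)) x"
      using cgenideal_valuation_ring[of "p [^]\<^bsub>?R\<^esub> Suc k"] pow[of "Suc k"]
      by (auto simp: valuation_ring_def simp del: R.nat_pow_Suc)
    then have "x \<noteq> \<zero>" "v x \<le> int k" by (auto simp: val_ge_def)
    then show "p [^]\<^bsub>?R\<^esub> k \<in> PIdl\<^bsub>?R\<^esub> x"
      using cgenideal_valuation_ring[OF x(1)] pow[of k] by (auto simp: val_ge_def valuation_ring_def)
  qed
  with P show thesis using that by blast
qed

end

theorem corollary5p10:
  fixes K :: "('a, 'b) ring_scheme" and v :: "'a \<Rightarrow> int" and d q :: nat
  defines "R \<equiv> valuation_ring K v" and "P \<equiv> valuation_ideal K v"
  assumes "nonarch_local_field K v"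
    and "q = card (carrier (R Quot P))"
    and "d > 1"
  shows "ask_zeta R P d (sl_mats R d) = ask_zeta R P d (gl_mats R d) \<and>
    ask_zeta R P d (gl_mats R d) =
      (1 - fps_const (1 / of_nat q ^ d) * fps_X) / (1 - fps_X)\<^sup>2"
proof -
  interpret nonarch_local_field K v by fact
  obtain p where p: "uniformized_domain R p" "PIdl\<^bsub>R\<^esub> p = P"
    unfolding R_def P_def by (rule uniformizer_exists)
  interpret U: uniformized_domain R p by (rule p)
  show ?thesis
    using U.ask_zeta_eq[OF \<open>d > 1\<close>] by (simp add: p(2) \<open>q = _\<close>)
qed

end
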